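(* Let $\alpha\in(0,1)$ and $S=(S_0,S_T)$ a traded asset. Then the following are equivalent: (a) $\rho_{\mathscr{A}^\alpha,S}$ is (globally) Lipschitz continuous; (b) $\mathrm{TVaR}_\alpha(S_T)<0$; (c) $\mathbb{P}[S_T=0]<\alpha$.
   Context: Let $(\Omega,\mathcal{F},\mathbb{P})$ be a probability space and $\mathscr{X}$ the Banach space of bounded $\mathcal{F}$-measurable functions $X:\Omega\to\mathbb{R}$ with the supremum norm and the pointwise order (functions are not identified almost surely); $\mathscr{X}_+=\{X\in\mathscr{X}: X\ge 0\}$. For $\beta\in(0,1)$ and $X\in\mathscr{X}$, $\mathrm{VaR}_\beta(X)=\inf\{m\in\mathbb{R}:\mathbb{P}[X+m<0]\le\beta\}$. For $\alpha\in(0,1)$, $\mathrm{TVaR}_\alpha(X)=\frac1\alpha\int_0^\alpha\mathrm{VaR}_\beta(X)\,d\beta$, and $\mathscr{A}^\alpha=\{X\in\mathscr{X}:\mathrm{TVaR}_\alpha(X)\le 0\}$. A traded asset is a pair $S=(S_0,S_T)$ with $S_0\in\mathbb{R}$, $S_0>0$, and $S_T\in\mathscr{X}_+$, $S_T\ne 0$. For $\mathscr{A}\subset\mathscr{X}$, $\rho_{\mathscr{A},S}:\mathscr{X}\to\mathbb{R}\cup\{-\infty,\infty\}$ is $\rho_{\mathscr{A},S}(X)=\inf\{m\in\mathbb{R}: X+\frac{m}{S_0}S_T\in\mathscr{A}\}$ (with $\inf\emptyset=\infty$). Globally Lipschitz continuous means: real-valued on all of $\mathscr{X}$ and Lipschitz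 with respect to the supremum norm. *)

theory Defs
  imports "HOL-Probability.Probability"
begin

text \<open>
  A bounded measurable function \<open>\<Omega> \<rightarrow> \<real>\<close> is represented by a total HOL function on the
  underlying type; only its values on \<open>\<Omega> = space M\<close> are ever used. Functions are not identified
  almost surely: order, norm and being nonzero refer to all points of \<open>space M\<close>.
\<close>

definition bdd_meas :: "'a measure \<Rightarrow> ('a \<Rightarrow> real) set" where
  "bdd_meas M = {X \<in> borel_measurable M. bounded (X ` space M)}"

definition bdd_meas_nonneg :: "'a measure \<Rightarrow> ('a \<Rightarrow> real) set" where
  "bdd_meas_nonneg M = {X \<in> bdd_meas M. \<forall>\<omega>\<in>space M. 0 \<le> X \<omega>}"

definition sup_norm :: "'a measure \<Rightarrow> ('a \<Rightarrow> real) \<Rightarrow> real" where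
  "sup_norm M X = (SUP \<omega>\<in>space M. \<bar>X \<omega>\<bar>)"

text \<open>
  The infimum is taken in the reals: for \<open>0 < \<beta> < 1\<close> and bounded measurable \<open>X\<close> on a probability
  space, the set below is nonempty and bounded from below.
\<close>

definition VaR :: "'a measure \<Rightarrow> real \<Rightarrow> ('a \<Rightarrow> real) \<Rightarrow> real" where
  "VaR M \<beta> X = Inf {m. measure M {\<omega> \<in> space M. X \<omega> + m < 0} \<le> \<beta>}"

definition TVaR :: "'a measure \<Rightarrow> real \<Rightarrow> ('a \<Rightarrow> real) \<Rightarrow> real" where
  "TVaR M \<alpha> X = 1 / \<alpha> * (LINT \<beta>:{0<..<\<alpha>}|lborel. VaR M \<beta> X)"

definition TVaR_acceptance :: "'a measure \<Rightarrow> real \<Rightarrow> ('a \<Rightarrow> real) set" where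
  "TVaR_acceptance M \<alpha> = {X \<in> bdd_meas M. TVaR M \<alpha> X \<le> 0}"

definition traded_asset :: "'a measure \<Rightarrow> real \<times> ('a \<Rightarrow> real) \<Rightarrow> bool" where
  "traded_asset M S \<longleftrightarrow>
     fst S > 0 \<and> snd S \<in> bdd_meas_nonneg M \<and> (\<exists>\<omega>\<in>space M. snd S \<omega> \<noteq> 0)"

definition risk_measure ::
  "('a \<Rightarrow> real) set \<Rightarrow> real \<times> ('a \<Rightarrow> real) \<Rightarrow> ('a \<Rightarrow> real) \<Rightarrow> ereal" where
  "risk_measure A S X = Inf (ereal ` {m. (\<lambda>\<omega>. X \<omega> + m / fst S * snd S \<omega>) \<in> A})"

definition globally_Lipschitz :: "'a measure \<Rightarrow> (('a \<Rightarrow> real) \<Rightarrow> ereal) \<Rightarrow> bool" where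
  "globally_Lipschitz M \<rho> \<longleftrightarrow>
     (\<forall>X\<in>bdd_meas M. \<bar>\<rho> X\<bar> \<noteq> \<infinity>) \<and>
     (\<exists>L\<ge>0. \<forall>X\<in>bdd_meas M. \<forall>Y\<in>bdd_meas M.
        \<bar>real_of_ereal (\<rho> X) - real_of_ereal (\<rho> Y)\<bar> \<le> L * sup_norm M (\<lambda>\<omega>. X \<omega> - Y \<omega>))"

end

theory Submission
  imports Defs
begin

text \<open>
  Since \<open>\<beta> \<mapsto> VaR\<^sub>\<beta> X\<close> under the uniform distribution on \<open>(0,1)\<close> has the law of \<open>-X\<close>, one obtains the
  Rockafellar--Uryasev formula: \<open>TVaR\<^sub>\<alpha> X\<close> is the minimum over \<open>m\<close> of
  \<open>m + E[max 0 (-X - m)] / \<alpha>\<close>, attained at \<open>m = VaR\<^sub>\<alpha> X\<close>. Subadditivity, monotonicity, cash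
  additivity and the equivalence of (b) and (c) are read off from it. If \<open>c = -TVaR\<^sub>\<alpha> S\<^sub>T > 0\<close>, then
  adding \<open>\<parallel>X - Y\<parallel> / c\<close> units of \<open>S\<^sub>T\<close> turns an acceptable \<open>Y + t S\<^sub>T\<close> into an acceptable
  \<open>X + (t + \<parallel>X - Y\<parallel> / c) S\<^sub>T\<close>, which gives the Lipschitz constant \<open>S\<^sub>0 / c\<close>. If
  \<open>P[S\<^sub>T = 0] \<ge> \<alpha>\<close>, then no position in \<open>S\<^sub>T\<close> makes the constant \<open>-1\<close> acceptable.
\<close>

lemma set_integrable_const_Ioo:
  fixes a b c :: real
  shows "set_integrable lborel {a<..<b} (\<lambda>_. c)"
  using emeasure_bounded_finite[OF bounded_Ioo[of a b]] unfolding set_integrable_def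
  by (intro integrable_scaleR_left integrable_real_indicator) simp_all

section \<open>Bounded measurable functions and the supremum norm\<close>

lemma bdd_measD:
  assumes "X \<in> bdd_meas M"
  shows "X \<in> borel_measurable M" and "\<exists>K. \<forall>\<omega>\<in>space M. \<bar>X \<omega>\<bar> \<le> K"
  using assms by (auto simp: bdd_meas_def bounded_iff)

lemma bdd_measI:
  assumes "X \<in> borel_measurable M" and "\<And>\<omega>. \<omega> \<in> space M \<Longrightarrow> \<bar>X \<omega>\<bar> \<le> K"
  shows "X \<in> bdd_meas M"
  using assms by (auto simp: bdd_meas_def bounded_iff)

lemma bdd_meas_const: "(\<lambda>_. c) \<in> bdd_meas M"
  by (rule bdd_measI[where K = "\<bar>c\<bar>"]) auto

lemma bdd_meas_add:
  assumes "X \<in> bdd_meas M" "Y \<in> bdd_meas M"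
  shows "(\<lambda>\<omega>. X \<omega> + Y \<omega>) \<in> bdd_meas M"
proof -
  obtain K L where "\<forall>\<omega>\<in>space M. \<bar>X \<omega>\<bar> \<le> K" "\<forall>\<omega>\<in>space M. \<bar>Y \<omega>\<bar> \<le> L"
    using bdd_measD(2) assms by metis
  then show ?thesis
    using bdd_measD(1)[OF assms(1)] bdd_measD(1)[OF assms(2)]
    by (intro bdd_measI[where K = "K + L"]) fastforce+
qed

lemma bdd_meas_scale:
  assumes "X \<in> bdd_meas M"
  shows "(\<lambda>\<omega>. c * X \<omega>) \<in> bdd_meas M"
proof -
  obtain K where "\<forall>\<omega>\<in>space M. \<bar>X \<omega>\<bar> \<le> K"
    using bdd_measD(2) assms by metis
  then show ?thesis
    using bdd_measD(1)[OF assms]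
    by (intro bdd_measI[where K = "\<bar>c\<bar> * K"]) (auto simp: abs_mult intro: mult_left_mono)
qed

lemma sup_norm_upper:
  assumes "X \<in> bdd_meas M" "\<omega> \<in> space M"
  shows "\<bar>X \<omega>\<bar> \<le> sup_norm M X"
proof -
  obtain K where "\<forall>\<omega>\<in>space M. \<bar>X \<omega>\<bar> \<le> K"
    using bdd_measD(2) assms by metis
  then show ?thesis
    unfolding sup_norm_def using assms(2)
    by (intro cSUP_upper) (auto simp: bdd_above_def)
qed

text \<open>The Rockafellar-Uryasev objective. Any trial level \<open>m\<close> bounds
  \<open>TVaR\<close> from above, so estimates on \<open>TVaR\<close> reduce to a good choice of
  \<open>m\<close>.\<close>

definition shortfall_objective :: "'a measure \<Rightarrow> real \<Rightarrow> ('a \<Rightarrow> real) \<Rightarrow> real \<Rightarrow> real" where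
  "shortfall_objective M \<alpha> X m = m + 1 / \<alpha> * (\<integral>\<omega>. max 0 (- X \<omega> - m) \<partial>M)"

context prob_space
begin

section \<open>Value at risk as a quantile of the loss\<close>

lemma cdf_uminus:
  assumes [measurable]: "X \<in> borel_measurable M"
  shows "cdf (distr M borel (\<lambda>\<omega>. - X \<omega>)) m = 1 - prob {\<omega> \<in> space M. X \<omega> + m < 0}"
proof -
  have "cdf (distr M borel (\<lambda>\<omega>. - X \<omega>)) m = prob {\<omega> \<in> space M. \<not> X \<omega> + m < 0}"
    unfolding cdf_def by (subst measure_distr) (auto intro!: arg_cong[where f = prob])
  also have "\<dots> = 1 - prob {\<omega> \<in> space M. X \<omega> + m < 0}"
    by (rule prob_neg) auto
  finally show ?thesis .
qed

text \<open>Complementing the event turns the tail condition on \<open>X\<close> into a lower bound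
  on the distribution function of the loss \<open>-X\<close>. This is the form of the pseudoinverse
  \<open>I\<close> in the locale \<open>cdf_distribution\<close>, taken at
  \<open>1 - \<beta>\<close>.\<close>

lemma VaR_eq_pseudoinverse:
  assumes "X \<in> borel_measurable M"
  shows "VaR M \<beta> X = Inf {m. 1 - \<beta> \<le> cdf (distr M borel (\<lambda>\<omega>. - X \<omega>)) m}"
  unfolding VaR_def cdf_uminus[OF assms] by (simp add: algebra_simps)

lemma cdf_distribution_uminus:
  assumes "X \<in> borel_measurable M"
  shows "cdf_distribution (distr M borel (\<lambda>\<omega>. - X \<omega>))"
  unfolding cdf_distribution_def using assms by (intro real_distribution_distr) auto

text \<open>The Galois connection between a distribution function and its pseudoinverse at
  \<open>1 - \<beta>\<close>, a point of (0,1). In particular the infimum defining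
  \<open>VaR\<close> is attained.\<close>

lemma VaR_le_iff:
  assumes "X \<in> borel_measurable M" "0 < \<beta>" "\<beta> < 1"
  shows "VaR M \<beta> X \<le> m \<longleftrightarrow> prob {\<omega> \<in> space M. X \<omega> + m < 0} \<le> \<beta>"
proof -
  interpret D: cdf_distribution "distr M borel (\<lambda>\<omega>. - X \<omega>)"
    using assms(1) by (rule cdf_distribution_uminus)
  show ?thesis
    using D.pseudoinverse[of "1 - \<beta>" m] assms
    by (auto simp: VaR_eq_pseudoinverse cdf_uminus)
qed

lemma VaR_antimono:
  assumes "X \<in> borel_measurable M" "0 < \<beta>" "\<beta> \<le> \<gamma>" "\<gamma> < 1"
  shows "VaR M \<gamma> X \<le> VaR M \<beta> X"
  using VaR_le_iff[of X \<gamma> "VaR M \<beta> X"] VaR_le_iff[of X \<beta> "VaR M \<beta> X"] assms by auto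

lemma abs_VaR_le:
  assumes "X \<in> borel_measurable M" "0 < \<beta>" "\<beta> < 1" and K: "\<And>\<omega>. \<omega> \<in> space M \<Longrightarrow> \<bar>X \<omega>\<bar> \<le> K"
  shows "\<bar>VaR M \<beta> X\<bar> \<le> K"
proof -
  have "{\<omega> \<in> space M. X \<omega> + K < 0} = {}"
    using K by fastforce
  then have "prob {\<omega> \<in> space M. X \<omega> + K < 0} = 0"
    by (simp only: measure_empty)
  then have "VaR M \<beta> X \<le> K"
    using assms by (simp add: VaR_le_iff)
  moreover have "- K \<le> VaR M \<beta> X"
  proof (rule ccontr)
    assume *: "\<not> - K \<le> VaR M \<beta> X"
    have "{\<omega> \<in> space M. X \<omega> + VaR M \<beta> X < 0} = space M"
      using K * by fastforce
    then show False
      using VaR_le_iff[of X \<beta> "VaR M \<beta> X"] assms by (simp add: prob_space)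
  qed
  ultimately show ?thesis by simp
qed

section \<open>Integration of \<open>VaR\<close> over the level\<close>

text \<open>Monotone functions are Borel. The domain is cut down to (0,1) because outside it the
  infimum may run over an empty or unbounded set.\<close>

lemma measurable_VaR:
  assumes "X \<in> borel_measurable M"
  shows "(\<lambda>\<beta>. VaR M \<beta> X) \<in> borel_measurable (restrict_space borel {0<..<1})"
proof -
  have "(\<lambda>\<beta>. - VaR M \<beta> X) \<in> borel_measurable (restrict_space borel {0<..<1})"
    by (intro borel_measurable_mono_on_fnc) (auto simp: mono_on_def intro: VaR_antimono assms)
  then show ?thesis by simp
qed

lemma set_integrable_VaR:
  assumes X: "X \<in> bdd_meas M" and "b \<le> 1"
  shows "set_integrable lborel {0<..<b} (\<lambda>\<beta>. VaR M \<beta> X)"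
proof -
  obtain K where K: "\<forall>\<omega>\<in>space M. \<bar>X \<omega>\<bar> \<le> K"
    using bdd_measD(2)[OF X] by metis
  have "(\<lambda>\<beta>. indicator {0<..<1} \<beta> *\<^sub>R VaR M \<beta> X) \<in> borel_measurable lborel"
    using measurable_VaR[OF bdd_measD(1)[OF X]]
    by (subst (asm) borel_measurable_restrict_space_iff) (auto simp: mult.commute)
  then have "set_integrable lborel {0<..<1} (\<lambda>\<beta>. VaR M \<beta> X)"
    unfolding set_integrable_def
    by (rule integrableI_bounded_set[where A = "{0<..<1}" and B = K, rotated])
      (use abs_VaR_le[OF bdd_measD(1)[OF X]] K in auto)
  then show ?thesis
    by (rule set_integrable_subset) (use assms in auto)
qed

text \<open>The quantile transform: the pseudoinverse pushes the uniform distribution on (0,1)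
  forward to the law of \<open>-X\<close>.\<close>

lemma set_integral_VaR:
  assumes [measurable]: "X \<in> borel_measurable M" "f \<in> borel_measurable borel"
  shows "(LINT \<beta>:{0<..<1}|lborel. f (VaR M \<beta> X) :: real) = expectation (\<lambda>\<omega>. f (- X \<omega>))"
proof -
  let ?D = "distr M borel (\<lambda>\<omega>. - X \<omega>)" and ?U = "restrict_space lborel {0<..<1::real}"
  interpret D: cdf_distribution ?D
    using assms(1) by (rule cdf_distribution_uminus)
  have I: "D.I \<in> borel_measurable ?U"
    using D.measurable_CI by (auto simp: measurable_def space_restrict_space sets_restrict_space)
  have "(LINT \<beta>:{0<..<1}|lborel. f (VaR M \<beta> X)) = (LINT \<beta>:{0<..<1}|lborel. f (D.I (1 - \<beta>)))"
    by (simp add: VaR_eq_pseudoinverse)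
  \<comment> \<open>The reflection of \<open>\<beta>\<close> to \<open>1 - \<beta>\<close> preserves
    Lebesgue measure on (0,1).\<close>
  also have "\<dots> = (LINT \<beta>:{0<..<1}|lborel. f (D.I \<beta>))"
    unfolding set_lebesgue_integral_def
    by (subst lborel_integral_real_affine[where c = "-1" and t = 1])
      (auto intro!: Bochner_Integration.integral_cong split: split_indicator)
  also have "\<dots> = (\<integral>\<beta>. f (D.I \<beta>) \<partial>?U)"
    unfolding set_lebesgue_integral_def by (subst integral_restrict_space) auto
  also have "\<dots> = (\<integral>x. f x \<partial>distr ?U borel D.I)"
    by (intro integral_distr[symmetric] I assms(2))
  also have "\<dots> = expectation (\<lambda>\<omega>. f (- X \<omega>))"
    unfolding D.distr_I_eq_M by (rule integral_distr) auto
  finally show ?thesis .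
qed

section \<open>The Rockafellar-Uryasev formula\<close>

lemma integrable_shortfall:
  assumes "X \<in> bdd_meas M"
  shows "integrable M (\<lambda>\<omega>. max 0 (- X \<omega> - m))"
proof -
  obtain K where K: "\<forall>\<omega>\<in>space M. \<bar>X \<omega>\<bar> \<le> K"
    using bdd_measD(2)[OF assms] by metis
  have [measurable]: "X \<in> borel_measurable M"
    using assms by (rule bdd_measD)
  show ?thesis
    by (rule integrable_const_bound[where B = "K + \<bar>m\<bar>"]) (use K in \<open>fastforce intro!: AE_I2\<close>)+
qed

lemma set_integrable_VaR_excess:
  assumes "X \<in> bdd_meas M" "b \<le> 1"
  shows "set_integrable lborel {0<..<b} (\<lambda>\<beta>. max 0 (VaR M \<beta> X - m))"
proof -
  have "set_integrable lborel {0<..<b} (\<lambda>\<beta>. VaR M \<beta> X - m)"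
    using set_integrable_VaR[OF assms] set_integrable_const_Ioo by (rule set_integral_diff)
  \<comment> \<open>The indicator may stand inside the maximum, since both expressions vanish off
    the interval.\<close>
  then have "integrable lborel (\<lambda>\<beta>. max 0 (indicator {0<..<b} \<beta> *\<^sub>R (VaR M \<beta> X - m)))"
    unfolding set_integrable_def by (intro integrable_max) auto
  then show ?thesis
    unfolding set_integrable_def
    by (rule Bochner_Integration.integrable_cong[THEN iffD1, rotated 2]) (auto split: split_indicator)
qed

text \<open>A number is at most \<open>m\<close> plus its excess over \<open>m\<close>. The excess
  is nonnegative, so its integral grows when (0,\<alpha>) is enlarged to (0,1), where it becomes an
  expectation.\<close>

lemma TVaR_le_shortfall_objective:
  assumes X: "X \<in> bdd_meas M" and \<alpha>: "0 < \<alpha>" "\<alpha> < 1"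
  shows "TVaR M \<alpha> X \<le> shortfall_objective M \<alpha> X m"
proof -
  let ?h = "\<lambda>\<beta>. max 0 (VaR M \<beta> X - m)"
  have h: "set_integrable lborel {0<..<b} ?h" if "b \<le> 1" for b
    using X that by (rule set_integrable_VaR_excess)
  have m: "set_integrable lborel {0<..<\<alpha>} (\<lambda>_. m)"
    by (rule set_integrable_const_Ioo)
  have "(LINT \<beta>:{0<..<\<alpha>}|lborel. VaR M \<beta> X) \<le> (LINT \<beta>:{0<..<\<alpha>}|lborel. m + ?h \<beta>)"
    using \<alpha> X by (intro set_integral_mono set_integrable_VaR set_integral_add(1) h m) auto
  also have "\<dots> = (LINT \<beta>:{0<..<\<alpha>}|lborel. m) + (LINT \<beta>:{0<..<\<alpha>}|lborel. ?h \<beta>)"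
    using \<alpha> by (intro set_integral_add(2) h m) auto
  also have "(LINT \<beta>:{0<..<\<alpha>}|lborel. m) = \<alpha> * m"
    using \<alpha> by (simp add: set_lebesgue_integral_def)
  also have "(LINT \<beta>:{0<..<\<alpha>}|lborel. ?h \<beta>) \<le> (LINT \<beta>:{0<..<1}|lborel. ?h \<beta>)"
    using \<alpha> h[of \<alpha>] h[of 1] unfolding set_lebesgue_integral_def set_integrable_def
    by (intro integral_mono) (auto split: split_indicator)
  also have "\<dots> = expectation (\<lambda>\<omega>. max 0 (- X \<omega> - m))"
    using bdd_measD(1)[OF X] by (intro set_integral_VaR) auto
  finally show ?thesis
    using \<alpha> by (simp add: TVaR_def shortfall_objective_def field_simps)
qed

text \<open>Both estimates of the upper bound are equalities at this level: as \<open>VaR\<close>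
  decreases in \<open>\<beta>\<close>, it is at least \<open>m\<close> below
  \<open>\<alpha>\<close>, and its excess over \<open>m\<close> vanishes from
  \<open>\<alpha>\<close> on.\<close>

lemma TVaR_eq_shortfall_objective:
  assumes X: "X \<in> bdd_meas M" and \<alpha>: "0 < \<alpha>" "\<alpha> < 1"
  shows "TVaR M \<alpha> X = shortfall_objective M \<alpha> X (VaR M \<alpha> X)"
proof -
  define m where "m = VaR M \<alpha> X"
  let ?h = "\<lambda>\<beta>. max 0 (VaR M \<beta> X - m)"
  note X' = bdd_measD(1)[OF X]
  have h: "set_integrable lborel {0<..<\<alpha>} ?h"
    using X \<alpha> by (intro set_integrable_VaR_excess) auto
  have m: "set_integrable lborel {0<..<\<alpha>} (\<lambda>_. m)"
    by (rule set_integrable_const_Ioo)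
  have "(LINT \<beta>:{0<..<\<alpha>}|lborel. VaR M \<beta> X) = (LINT \<beta>:{0<..<\<alpha>}|lborel. m + ?h \<beta>)"
    using \<alpha> VaR_antimono[OF X', of _ \<alpha>]
    by (intro set_lebesgue_integral_cong) (auto simp: m_def max_def)
  also have "\<dots> = (LINT \<beta>:{0<..<\<alpha>}|lborel. m) + (LINT \<beta>:{0<..<\<alpha>}|lborel. ?h \<beta>)"
    by (intro set_integral_add(2) h m)
  also have "(LINT \<beta>:{0<..<\<alpha>}|lborel. m) = \<alpha> * m"
    using \<alpha> by (simp add: set_lebesgue_integral_def)
  also have "(LINT \<beta>:{0<..<\<alpha>}|lborel. ?h \<beta>) = (LINT \<beta>:{0<..<1}|lborel. ?h \<beta>)"
    using \<alpha> VaR_antimono[OF X', of \<alpha>] unfolding set_lebesgue_integral_def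
    by (intro Bochner_Integration.integral_cong)
      (auto simp: m_def max_def intro: antisym split: split_indicator)
  also have "\<dots> = expectation (\<lambda>\<omega>. max 0 (- X \<omega> - m))"
    using X' by (intro set_integral_VaR) auto
  finally show ?thesis
    using \<alpha> by (simp add: TVaR_def shortfall_objective_def m_def field_simps)
qed

section \<open>Subadditivity, scaling and monotonicity of \<open>TVaR\<close>\<close>

text \<open>The sum of the two optimal levels serves as trial level for the sum, and the positive
  part is subadditive.\<close>

lemma TVaR_add_le:
  assumes X: "X \<in> bdd_meas M" and Y: "Y \<in> bdd_meas M" and \<alpha>: "0 < \<alpha>" "\<alpha> < 1"
  shows "TVaR M \<alpha> (\<lambda>\<omega>. X \<omega> + Y \<omega>) \<le> TVaR M \<alpha> X + TVaR M \<alpha> Y"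
proof -
  let ?m = "VaR M \<alpha> X" and ?n = "VaR M \<alpha> Y"
  have "expectation (\<lambda>\<omega>. max 0 (- (X \<omega> + Y \<omega>) - (?m + ?n)))
      \<le> expectation (\<lambda>\<omega>. max 0 (- X \<omega> - ?m) + max 0 (- Y \<omega> - ?n))"
    by (intro integral_mono integrable_shortfall Bochner_Integration.integrable_add bdd_meas_add X Y)
      auto
  also have "\<dots> = expectation (\<lambda>\<omega>. max 0 (- X \<omega> - ?m)) + expectation (\<lambda>\<omega>. max 0 (- Y \<omega> - ?n))"
    by (intro Bochner_Integration.integral_add integrable_shortfall X Y)
  finally have "shortfall_objective M \<alpha> (\<lambda>\<omega>. X \<omega> + Y \<omega>) (?m + ?n)
      \<le> shortfall_objective M \<alpha> X ?m + shortfall_objective M \<alpha> Y ?n"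
    using \<alpha> by (simp add: shortfall_objective_def divide_simps) (simp add: algebra_simps)
  then show ?thesis
    using TVaR_le_shortfall_objective[OF bdd_meas_add[OF X Y] \<alpha>, of "?m + ?n"]
    by (simp add: TVaR_eq_shortfall_objective X Y \<alpha>)
qed

lemma TVaR_scale_le:
  assumes X: "X \<in> bdd_meas M" and \<alpha>: "0 < \<alpha>" "\<alpha> < 1" and "0 \<le> s"
  shows "TVaR M \<alpha> (\<lambda>\<omega>. s * X \<omega>) \<le> s * TVaR M \<alpha> X"
proof -
  let ?m = "VaR M \<alpha> X"
  have "max 0 (- (s * X \<omega>) - s * ?m) = s * max 0 (- X \<omega> - ?m)" for \<omega>
    using max_mult_distrib_left[of s 0 "- X \<omega> - ?m"] \<open>0 \<le> s\<close> by (simp add: algebra_simps)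
  then have "shortfall_objective M \<alpha> (\<lambda>\<omega>. s * X \<omega>) (s * ?m) = s * shortfall_objective M \<alpha> X ?m"
    by (simp add: shortfall_objective_def algebra_simps)
  then show ?thesis
    using TVaR_le_shortfall_objective[OF bdd_meas_scale[OF X] \<alpha>, of s "s * ?m"]
    by (simp add: TVaR_eq_shortfall_objective X \<alpha>)
qed

text \<open>Monotonicity and cash additivity in one estimate, by the trial level
  \<open>?m + k\<close> for \<open>Y\<close>. The constant \<open>k\<close> may be negative;
  \<open>k = -1\<close> occurs below.\<close>

lemma TVaR_le_add:
  assumes X: "X \<in> bdd_meas M" and Y: "Y \<in> bdd_meas M" and \<alpha>: "0 < \<alpha>" "\<alpha> < 1"
    and le: "\<And>\<omega>. \<omega> \<in> space M \<Longrightarrow> X \<omega> \<le> Y \<omega> + k"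
  shows "TVaR M \<alpha> Y \<le> TVaR M \<alpha> X + k"
proof -
  let ?m = "VaR M \<alpha> X"
  have "expectation (\<lambda>\<omega>. max 0 (- Y \<omega> - (?m + k))) \<le> expectation (\<lambda>\<omega>. max 0 (- X \<omega> - ?m))"
    using le by (intro integral_mono integrable_shortfall X Y) fastforce
  then have "shortfall_objective M \<alpha> Y (?m + k) \<le> shortfall_objective M \<alpha> X ?m + k"
    using \<alpha> by (simp add: shortfall_objective_def divide_simps) (simp add: algebra_simps)
  then show ?thesis
    using TVaR_le_shortfall_objective[OF Y \<alpha>, of "?m + k"]
    by (simp add: TVaR_eq_shortfall_objective[OF X \<alpha>])
qed

section \<open>The sign of \<open>TVaR\<close> and the mass at zero\<close>

text \<open>On the zero set the shortfall below level \<open>m\<close> is the positive part of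
  \<open>-m\<close>. A mass of at least \<open>\<alpha>\<close> there makes the expectation term of
  the objective outweigh a negative \<open>m\<close>. The sign of \<open>X\<close> is left free, so
  that short positions are covered as well.\<close>

lemma TVaR_nonneg_if_prob_zero_ge:
  assumes X: "X \<in> bdd_meas M" and \<alpha>: "0 < \<alpha>" "\<alpha> < 1"
    and p: "\<alpha> \<le> prob {\<omega> \<in> space M. X \<omega> = 0}"
  shows "0 \<le> TVaR M \<alpha> X"
proof -
  have [measurable]: "X \<in> borel_measurable M"
    using X by (rule bdd_measD)
  let ?Z = "{\<omega> \<in> space M. X \<omega> = 0}" and ?m = "VaR M \<alpha> X"
  have "\<alpha> * max 0 (- ?m) \<le> prob ?Z * max 0 (- ?m)"
    using p by (intro mult_right_mono) auto
  also have "\<dots> = expectation (\<lambda>\<omega>. indicator ?Z \<omega> * max 0 (- ?m))"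
    by simp
  also have "\<dots> \<le> expectation (\<lambda>\<omega>. max 0 (- X \<omega> - ?m))"
    by (intro integral_mono integrable_shortfall[OF X] integrable_mult_left integrable_real_indicator)
      (auto simp: less_top[symmetric] split: split_indicator)
  finally have "max 0 (- ?m) \<le> 1 / \<alpha> * expectation (\<lambda>\<omega>. max 0 (- X \<omega> - ?m))"
    by (simp only: times_divide_eq_left mult_1_left pos_le_divide_eq[OF \<alpha>(1)] mult.commute[of _ \<alpha>])
  then show ?thesis
    unfolding TVaR_eq_shortfall_objective[OF X \<alpha>] shortfall_objective_def by linarith
qed

lemma TVaR_neg_if_prob_zero_less:
  assumes X: "X \<in> bdd_meas M" and \<alpha>: "0 < \<alpha>" "\<alpha> < 1"
    and nonneg: "\<And>\<omega>. \<omega> \<in> space M \<Longrightarrow> 0 \<le> X \<omega>"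
    and p: "prob {\<omega> \<in> space M. X \<omega> = 0} < \<alpha>"
  shows "TVaR M \<alpha> X < 0"
proof -
  have [measurable]: "X \<in> borel_measurable M"
    using X by (rule bdd_measD)
  let ?A = "\<lambda>n. {\<omega> \<in> space M. X \<omega> < inverse (real (Suc n))}"
  \<comment> \<open>Continuity from above: for nonnegative \<open>X\<close> these sets shrink to the
    zero set, so one of them already has probability below \<open>\<alpha>\<close>.\<close>
  have "(\<lambda>n. prob (?A n)) \<longlonglongrightarrow> prob (\<Inter>n. ?A n)"
  proof (rule finite_Lim_measure_decseq)
    show "decseq ?A"
      unfolding decseq_def by (auto intro: less_le_trans simp: le_imp_inverse_le)
  qed auto
  moreover have "(\<Inter>n. ?A n) = {\<omega> \<in> space M. X \<omega> = 0}"
  proof (intro equalityI subsetI)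
    fix \<omega> assume "\<omega> \<in> (\<Inter>n. ?A n)"
    then have "\<omega> \<in> space M" "\<And>n. X \<omega> < inverse (real (Suc n))" by auto
    then show "\<omega> \<in> {\<omega> \<in> space M. X \<omega> = 0}"
      using nonneg[of \<omega>] reals_Archimedean[of "X \<omega>"] by (auto simp: less_le_not_le)
  qed auto
  ultimately have "eventually (\<lambda>n. prob (?A n) < \<alpha>) sequentially"
    using p by (simp add: order_tendstoD)
  then obtain n where n: "prob (?A n) < \<alpha>"
    by (auto simp: eventually_sequentially)
  define e where "e = inverse (real (Suc n))"
  let ?B = "{\<omega> \<in> space M. X \<omega> < e}"
  have "e > 0" by (simp add: e_def)
  \<comment> \<open>At the trial level \<open>-e\<close> the shortfall is the positive part of
    \<open>e - X\<close>, which is at most \<open>e\<close> and vanishes off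
    \<open>?B\<close>.\<close>
  have "expectation (\<lambda>\<omega>. max 0 (- X \<omega> - - e)) \<le> expectation (\<lambda>\<omega>. indicator ?B \<omega> * e)"
    using nonneg \<open>e > 0\<close>
    by (intro integral_mono integrable_shortfall[OF X] integrable_mult_left integrable_real_indicator)
      (auto simp: less_top[symmetric] split: split_indicator)
  also have "\<dots> = prob ?B * e"
    by simp
  also have "\<dots> < \<alpha> * e"
    using n \<open>e > 0\<close> by (simp add: e_def)
  finally have "shortfall_objective M \<alpha> X (- e) < 0"
    using \<alpha> by (simp add: shortfall_objective_def field_simps)
  then show ?thesis
    using TVaR_le_shortfall_objective[OF X \<alpha>, of "- e"] by simp
qed

section \<open>Lipschitz continuity of the risk measure, and its failure\<close>

lemma globally_Lipschitz_risk_measure: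
  assumes \<alpha>: "0 < \<alpha>" "\<alpha> < 1" and S: "S \<in> bdd_meas M" and s: "0 < s"
    and neg: "TVaR M \<alpha> S < 0"
  shows "globally_Lipschitz M (risk_measure (TVaR_acceptance M \<alpha>) (s, S))"
proof -
  define c where "c = - TVaR M \<alpha> S"
  define R where "R X = {m. TVaR M \<alpha> (\<lambda>\<omega>. X \<omega> + m / s * S \<omega>) \<le> 0}" for X
  have c: "c > 0"
    using neg by (simp add: c_def)
  have port: "(\<lambda>\<omega>. X \<omega> + m * S \<omega>) \<in> bdd_meas M" if "X \<in> bdd_meas M" for X m
    using that S by (intro bdd_meas_add bdd_meas_scale)
  \<comment> \<open>Each further unit of \<open>S\<close> lowers \<open>TVaR\<close> by at least
    \<open>c\<close>.\<close>
  have descent: "TVaR M \<alpha> (\<lambda>\<omega>. X \<omega> + (t + r) * S \<omega>) \<le> TVaR M \<alpha> (\<lambda>\<omega>. X \<omega> + t * S \<omega>) - r * c"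
    if X: "X \<in> bdd_meas M" and "r \<ge> 0" for X t r
  proof -
    have "TVaR M \<alpha> (\<lambda>\<omega>. (X \<omega> + t * S \<omega>) + r * S \<omega>)
        \<le> TVaR M \<alpha> (\<lambda>\<omega>. X \<omega> + t * S \<omega>) + TVaR M \<alpha> (\<lambda>\<omega>. r * S \<omega>)"
      by (intro TVaR_add_le port X bdd_meas_scale S \<alpha>)
    moreover have "TVaR M \<alpha> (\<lambda>\<omega>. r * S \<omega>) \<le> r * TVaR M \<alpha> S"
      using \<open>r \<ge> 0\<close> by (intro TVaR_scale_le S \<alpha>)
    ultimately show ?thesis
      by (simp add: c_def algebra_simps)
  qed
  \<comment> \<open>Replacing \<open>Y\<close> by \<open>X\<close> raises \<open>TVaR\<close> by at
    most \<open>k\<close>. This is offset by \<open>k / c\<close> units of \<open>S\<close>, which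
    cost \<open>s / c * k\<close>.\<close>
  have shift: "m + s / c * k \<in> R X"
    if X: "X \<in> bdd_meas M" and Y: "Y \<in> bdd_meas M" and m: "m \<in> R Y" and "k \<ge> 0"
      and k: "\<And>\<omega>. \<omega> \<in> space M \<Longrightarrow> \<bar>X \<omega> - Y \<omega>\<bar> \<le> k" for X Y m k
  proof -
    have "TVaR M \<alpha> (\<lambda>\<omega>. X \<omega> + (m / s + k / c) * S \<omega>)
        \<le> TVaR M \<alpha> (\<lambda>\<omega>. X \<omega> + m / s * S \<omega>) - k / c * c"
      using \<open>k \<ge> 0\<close> c by (intro descent X) auto
    also have "TVaR M \<alpha> (\<lambda>\<omega>. X \<omega> + m / s * S \<omega>) \<le> TVaR M \<alpha> (\<lambda>\<omega>. Y \<omega> + m / s * S \<omega>) + k"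
      using k by (intro TVaR_le_add port X Y \<alpha>) fastforce
    also have "TVaR M \<alpha> (\<lambda>\<omega>. Y \<omega> + m / s * S \<omega>) \<le> 0"
      using m by (simp add: R_def)
    finally have "TVaR M \<alpha> (\<lambda>\<omega>. X \<omega> + (m / s + k / c) * S \<omega>) \<le> 0"
      using c by simp
    moreover have "m / s + k / c = (m + s / c * k) / s"
      using s c by (simp add: field_simps)
    ultimately show ?thesis
      by (simp add: R_def)
  qed
  have zero: "0 \<in> R (\<lambda>_. 0)"
    using TVaR_scale_le[OF S \<alpha>, of 0] by (simp add: R_def)
  \<comment> \<open>For negative \<open>m\<close>, buying back the \<open>- m / s\<close> units sold
    would bring the null position strictly below \<open>TVaR\<close> zero.\<close>
  have R_zero: "0 \<le> m" if "m \<in> R (\<lambda>_. 0)" for m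
  proof (rule ccontr)
    assume "\<not> 0 \<le> m"
    then have m: "m < 0" by simp
    have "0 \<le> TVaR M \<alpha> (\<lambda>_. 0)"
      using \<alpha> by (intro TVaR_nonneg_if_prob_zero_ge bdd_meas_const) (auto simp: prob_space)
    also have "\<dots> \<le> TVaR M \<alpha> (\<lambda>\<omega>. 0 + m / s * S \<omega>) - (- m / s) * c"
      using descent[OF bdd_meas_const, of "- m / s" 0 "m / s"] divide_neg_pos[OF m s] by simp
    also have "\<dots> \<le> 0 - (- m / s) * c"
      using that by (simp add: R_def)
    also have "\<dots> < 0"
      using m s c by (simp add: field_simps mult_pos_neg)
    finally show False by simp
  qed
  \<comment> \<open>Finiteness comes from comparing \<open>X\<close> with the null position in both
    directions. The bound \<open>max 0 K\<close> meets the sign condition of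
    \<open>shift\<close>.\<close>
  have R: "R X \<noteq> {}" "bdd_below (R X)" if X: "X \<in> bdd_meas M" for X
  proof -
    obtain K where K: "\<forall>\<omega>\<in>space M. \<bar>X \<omega>\<bar> \<le> K"
      using bdd_measD(2)[OF X] by metis
    then have "\<forall>\<omega>\<in>space M. \<bar>X \<omega>\<bar> \<le> max 0 K"
      by fastforce
    then have "0 + s / c * max 0 K \<in> R X"
      by (intro shift[OF X bdd_meas_const[of 0] zero]) auto
    then show "R X \<noteq> {}" by blast
    have "m + s / c * max 0 K \<in> R (\<lambda>_. 0)" if "m \<in> R X" for m
      using \<open>\<forall>\<omega>\<in>space M. \<bar>X \<omega>\<bar> \<le> max 0 K\<close>
      by (intro shift[OF bdd_meas_const[of 0] X that]) auto
    then have "- (s / c * max 0 K) \<le> m" if "m \<in> R X" for m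
      using R_zero[of "m + s / c * max 0 K"] that by simp
    then show "bdd_below (R X)"
      by (rule bdd_belowI)
  qed
  have \<rho>: "risk_measure (TVaR_acceptance M \<alpha>) (s, S) X = ereal (Inf (R X))" if "X \<in> bdd_meas M" for X
  proof -
    have "{m. (\<lambda>\<omega>. X \<omega> + m / s * S \<omega>) \<in> TVaR_acceptance M \<alpha>} = R X"
      unfolding TVaR_acceptance_def R_def using port[OF that] by blast
    then show ?thesis
      using R[OF that] by (simp add: risk_measure_def ereal_Inf')
  qed
  \<comment> \<open>The one-sided bound suffices, as exchanging \<open>X\<close> and
    \<open>Y\<close> gives the absolute value.\<close>
  have le: "Inf (R X) \<le> Inf (R Y) + s / c * sup_norm M (\<lambda>\<omega>. X \<omega> - Y \<omega>)"
    if X: "X \<in> bdd_meas M" and Y: "Y \<in> bdd_meas M" for X Y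
  proof -
    let ?k = "sup_norm M (\<lambda>\<omega>. X \<omega> - Y \<omega>)"
    have "(\<lambda>\<omega>. X \<omega> - Y \<omega>) \<in> bdd_meas M"
      using bdd_meas_add[OF X bdd_meas_scale[OF Y, of "-1"]] by simp
    then have k: "\<And>\<omega>. \<omega> \<in> space M \<Longrightarrow> \<bar>X \<omega> - Y \<omega>\<bar> \<le> ?k"
      by (rule sup_norm_upper)
    \<comment> \<open>A point of the space is at hand because its total mass is one; it makes the
      supremum norm nonnegative.\<close>
    obtain \<omega>\<^sub>0 where "\<omega>\<^sub>0 \<in> space M"
      using not_empty by blast
    then have "?k \<ge> 0"
      using k[of \<omega>\<^sub>0] by linarith
    have "Inf (R X) - s / c * ?k \<le> Inf (R Y)"
    proof (rule cInf_greatest)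
      fix m assume "m \<in> R Y"
      then have "Inf (R X) \<le> m + s / c * ?k"
        using R[OF X] shift[OF X Y _ \<open>?k \<ge> 0\<close> k] by (intro cInf_lower)
      then show "Inf (R X) - s / c * ?k \<le> m" by simp
    qed (rule R[OF Y])
    then show ?thesis by simp
  qed
  have sym: "sup_norm M (\<lambda>\<omega>. Y \<omega> - X \<omega>) = sup_norm M (\<lambda>\<omega>. X \<omega> - Y \<omega>)" for X Y
    by (simp add: sup_norm_def abs_minus_commute)
  show ?thesis
    unfolding globally_Lipschitz_def
  proof (intro conjI ballI exI[of _ "s / c"])
    fix X Y assume "X \<in> bdd_meas M" "Y \<in> bdd_meas M"
    then show "\<bar>real_of_ereal (risk_measure (TVaR_acceptance M \<alpha>) (s, S) X)
        - real_of_ereal (risk_measure (TVaR_acceptance M \<alpha>) (s, S) Y)\<bar>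
        \<le> s / c * sup_norm M (\<lambda>\<omega>. X \<omega> - Y \<omega>)"
      using le[of X Y] le[of Y X] by (simp add: \<rho> sym[of Y X])
  qed (use s c \<rho> in auto)
qed

text \<open>Every multiple of \<open>S\<close> vanishes wherever \<open>S\<close> does, so its
  \<open>TVaR\<close> is nonnegative, and subtracting one leaves it positive. The infimum is then
  over the empty set.\<close>

lemma risk_measure_minus_one:
  assumes \<alpha>: "0 < \<alpha>" "\<alpha> < 1" and S: "S \<in> bdd_meas M"
    and p: "\<alpha> \<le> prob {\<omega> \<in> space M. S \<omega> = 0}"
  shows "risk_measure (TVaR_acceptance M \<alpha>) (s, S) (\<lambda>_. - 1) = \<infinity>"
proof -
  have pos: "TVaR M \<alpha> (\<lambda>\<omega>. - 1 + t * S \<omega>) > 0" for t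
  proof -
    have [measurable]: "S \<in> borel_measurable M"
      using S by (rule bdd_measD)
    have "prob {\<omega> \<in> space M. S \<omega> = 0} \<le> prob {\<omega> \<in> space M. t * S \<omega> = 0}"
      by (intro finite_measure_mono) auto
    then have "0 \<le> TVaR M \<alpha> (\<lambda>\<omega>. t * S \<omega>)"
      using p by (intro TVaR_nonneg_if_prob_zero_ge bdd_meas_scale S \<alpha>) auto
    also have "\<dots> \<le> TVaR M \<alpha> (\<lambda>\<omega>. - 1 + t * S \<omega>) + - 1"
      by (intro TVaR_le_add bdd_meas_add bdd_meas_const bdd_meas_scale S \<alpha>) simp
    finally show ?thesis by simp
  qed
  have "(\<lambda>\<omega>. - 1 + m / s * S \<omega>) \<notin> TVaR_acceptance M \<alpha>" for m
    using pos[of "m / s"] by (simp add: TVaR_acceptance_def)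
  then show ?thesis
    by (simp add: risk_measure_def top_ereal_def)
qed

end

theorem proposition4p17:
  fixes M :: "'a measure" and \<alpha> :: real and S :: "real \<times> ('a \<Rightarrow> real)"
  assumes "prob_space M"
    and "0 < \<alpha>" and "\<alpha> < 1"
    and "traded_asset M S"
  shows "(globally_Lipschitz M (risk_measure (TVaR_acceptance M \<alpha>) S) \<longleftrightarrow> TVaR M \<alpha> (snd S) < 0)
    \<and> (TVaR M \<alpha> (snd S) < 0 \<longleftrightarrow> measure M {\<omega> \<in> space M. snd S \<omega> = 0} < \<alpha>)"
proof -
  interpret prob_space M by fact
  obtain s T where S: "S = (s, T)" by (cases S)
  have s: "0 < s" and T: "T \<in> bdd_meas M" and nonneg: "\<And>\<omega>. \<omega> \<in> space M \<Longrightarrow> 0 \<le> T \<omega>"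
    using assms(4) by (auto simp: S traded_asset_def bdd_meas_nonneg_def)
  have bc: "TVaR M \<alpha> T < 0 \<longleftrightarrow> prob {\<omega> \<in> space M. T \<omega> = 0} < \<alpha>"
    using TVaR_nonneg_if_prob_zero_ge[OF T assms(2,3)]
      TVaR_neg_if_prob_zero_less[OF T assms(2,3) nonneg] by fastforce
  \<comment> \<open>From (a) to (c): otherwise the constant \<open>-1\<close> would have infinite
    risk, although (a) demands real values.\<close>
  moreover have "prob {\<omega> \<in> space M. T \<omega> = 0} < \<alpha>"
    if "globally_Lipschitz M (risk_measure (TVaR_acceptance M \<alpha>) (s, T))"
  proof (rule ccontr)
    assume "\<not> prob {\<omega> \<in> space M. T \<omega> = 0} < \<alpha>"
    then have "risk_measure (TVaR_acceptance M \<alpha>) (s, T) (\<lambda>_. - 1) = \<infinity>"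
      by (intro risk_measure_minus_one assms(2,3) T) simp
    moreover have "\<bar>risk_measure (TVaR_acceptance M \<alpha>) (s, T) (\<lambda>_. - 1)\<bar> \<noteq> \<infinity>"
      using that[unfolded globally_Lipschitz_def, THEN conjunct1] bdd_meas_const by (rule bspec)
    ultimately show False by simp
  qed
  ultimately show ?thesis
    using globally_Lipschitz_risk_measure[OF assms(2,3) T s] by (auto simp: S)
qed

end
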